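(* Let $\mathbb{F}\in\{\mathbb{R},\mathbb{C}\}$, with $\beta=1$ if $\mathbb{F}=\mathbb{R}$ and $\beta=2$ if $\mathbb{F}=\mathbb{C}$. Let $A\in\mathbb{F}^{m\times n}$ be an input matrix, let $\Theta\in\mathbb{F}^{q\times m}$ be a standard normal matrix, and let $W=\Theta A\in\mathbb{F}^{q\times n}$. Let $\hat A_{\rm out}\in\mathbb{F}^{m\times n}$ be an approximation of $A$, computed via any method, that does not depend on the matrices $\Theta, W$. Define $$\mathrm{err}_2^2(\hat A_{\rm out})=\frac{1}{\beta q}\,\|W-\Theta\hat A_{\rm out}\|_2^2=\frac{1}{\beta q}\,\|\Theta(A-\hat A_{\rm out})\|_2^2.$$ Then $$\mathbb{P}_\Theta\left\{\mathrm{err}_2^2(\hat A_{\rm out})\le(1-\varepsilon)\,\|A-\hat A_{\rm out}\|_2^2\right\}\le\left[e^{\varepsilon}(1-\varepsilon)\right]^{\beta q/2}\quad\text{for }\varepsilon\in(0,1).$$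
   Context: $\|\cdot\|_2$ is the Schatten 2-norm (Frobenius norm). A standard normal matrix over $\mathbb{R}$ has independent $N(0,1)$ entries; over $\mathbb{C}$ its entries are independent and of the form $g_1+\mathrm{i}g_2$ with $g_1,g_2$ independent real $N(0,1)$ variables. The matrices $A$ and $\hat A_{\rm out}$ are treated as fixed with respect to $\Theta$; $\mathbb{P}_\Theta$ is probability over $\Theta$.
   Formalization: The formal theorem assumes that the approximation differs from A; if they are equal, the error and the right side are both 0, so the probability is 1 while the bound is less than 1, and the claim as stated fails. *)

theory Defs
  imports "HOL-Probability.Probability"
begin

definition frob_norm :: "'a::real_normed_vector ^ 'n ^ 'm \<Rightarrow> real" where
  "frob_norm A = sqrt (\<Sum>i\<in>UNIV. \<Sum>j\<in>UNIV. (norm (A $ i $ j))\<^sup>2)"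

lemma frob_norm_eq_norm: "frob_norm A = norm A"
  by (simp add: frob_norm_def norm_vec_def L2_set_def sum_nonneg)

text \<open>A random matrix is a function from the sample space to matrices. The matrix type
  \<open>'a ^ 'm ^ 'q\<close> has \<open>CARD('q)\<close> rows and \<open>CARD('m)\<close> columns.\<close>

definition std_normal_real_matrix :: "'w measure \<Rightarrow> ('w \<Rightarrow> real ^ 'm ^ 'q) \<Rightarrow> bool" where
  "std_normal_real_matrix M \<Theta> \<longleftrightarrow>
     prob_space.indep_vars M (\<lambda>_. borel) (\<lambda>(i, j) \<omega>. \<Theta> \<omega> $ i $ j) (UNIV :: ('q \<times> 'm) set) \<and>
     (\<forall>i j. distributed M lborel (\<lambda>\<omega>. \<Theta> \<omega> $ i $ j) std_normal_density)"

text \<open>In the complex case the real and imaginary parts each have variance 1, so an entry has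
  \<open>E |z|\<^sup>2 = 2\<close>.\<close>

definition std_normal_complex_matrix :: "'w measure \<Rightarrow> ('w \<Rightarrow> complex ^ 'm ^ 'q) \<Rightarrow> bool" where
  "std_normal_complex_matrix M \<Theta> \<longleftrightarrow>
     prob_space.indep_vars M (\<lambda>_. borel) (\<lambda>(i, j) \<omega>. \<Theta> \<omega> $ i $ j) (UNIV :: ('q \<times> 'm) set) \<and>
     (\<forall>i j. prob_space.indep_var M borel (\<lambda>\<omega>. Re (\<Theta> \<omega> $ i $ j)) borel (\<lambda>\<omega>. Im (\<Theta> \<omega> $ i $ j)) \<and>
            distributed M lborel (\<lambda>\<omega>. Re (\<Theta> \<omega> $ i $ j)) std_normal_density \<and>
            distributed M lborel (\<lambda>\<omega>. Im (\<Theta> \<omega> $ i $ j)) std_normal_density)"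

text \<open>The squared error estimate, for a realization \<open>T\<close> of the test matrix and the sketch
  \<open>W = T ** A\<close>; \<open>\<beta>\<close> is the real dimension of the scalar field.\<close>

definition err_sq ::
  "real \<Rightarrow> 'a::real_normed_field ^ 'm ^ 'q \<Rightarrow> 'a ^ 'n ^ 'q \<Rightarrow> 'a ^ 'n ^ 'm \<Rightarrow> real" where
  "err_sq \<beta> T W B = 1 / (\<beta> * real CARD('q)) * (frob_norm (W - T ** B))\<^sup>2"

lemma err_sq_sketch:
  fixes T :: "'a::real_normed_field ^ 'm ^ 'q" and A B :: "'a ^ 'n ^ 'm"
  shows "err_sq \<beta> T (T ** A) B = 1 / (\<beta> * real CARD('q)) * (frob_norm (T ** (A - B)))\<^sup>2"
proof -
  have "T ** A - T ** B = T ** (A - B)"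
    by (simp add: vec_eq_iff matrix_matrix_mult_def sum_subtractf right_diff_distrib)
  then show ?thesis by (simp add: err_sq_def)
qed

end

theory Submission imports Defs
begin

text \<open>This is a Chernoff bound for \<open>Y = \<parallel>\<Theta> D\<parallel>\<^sup>2\<close> with \<open>D = A - B\<close>: one needs
  \<open>E exp (- t Y) \<le> (1 + 2 t \<parallel>D\<parallel>\<^sup>2) powr (- \<beta> q / 2)\<close> and takes
  \<open>1 + 2 t \<parallel>D\<parallel>\<^sup>2 = 1 / (1 - \<epsilon>)\<close>. The rows of \<open>\<Theta>\<close> are independent, so it suffices to bound
  \<open>E exp (- z S z\<^sup>*) \<le> (1 + 2 tr S) powr (- \<beta> / 2)\<close> for a single Gaussian row \<open>z\<close> and a positive
  semidefinite \<open>S\<close>. No diagonalisation or rotation invariance is used: integrating out the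
  coordinate \<open>k\<close> gives the factor \<open>(1 + 2 S\<^sub>k\<^sub>k) powr (- \<beta> / 2)\<close> and replaces \<open>S\<^sub>i\<^sub>j\<close> by
  \<open>S\<^sub>i\<^sub>j - 2 S\<^sub>i\<^sub>k S\<^sub>k\<^sub>j / (1 + 2 S\<^sub>k\<^sub>k)\<close>, and the inequalities
  \<open>\<bar>S\<^sub>i\<^sub>k\<bar>\<^sup>2 \<le> S\<^sub>k\<^sub>k S\<^sub>i\<^sub>i\<close> control the trace of the new form.\<close>

section \<open>Hermitian forms and elimination of one coordinate\<close>

text \<open>The convention is \<open>z S z^*\<close> with a row vector \<open>z\<close>, because
  rows of \<Theta> multiply \<open>D\<close> from the left. For Hermitian \<open>S\<close> the
  double sum is already real, so \<open>Re\<close> only changes the type.\<close>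

definition herm_form :: "('i \<Rightarrow> 'i \<Rightarrow> complex) \<Rightarrow> 'i set \<Rightarrow> ('i \<Rightarrow> complex) \<Rightarrow> real" where
  "herm_form S I z = Re (\<Sum>i\<in>I. \<Sum>j\<in>I. z i * S i j * cnj (z j))"

text \<open>Row \<open>k\<close> and column \<open>k\<close> contribute mutually conjugate cross
  terms, which merge into twice a real part. This isolates the dependence on the coordinate that is
  to be integrated out.\<close>

lemma herm_form_insert:
  assumes "finite I" "k \<notin> I"
    and herm: "\<And>i j. i \<in> insert k I \<Longrightarrow> j \<in> insert k I \<Longrightarrow> S j i = cnj (S i j)"
  shows "herm_form S (insert k I) (x(k := y)) =
    Re (S k k) * (cmod y)\<^sup>2 + 2 * Re (y * cnj (\<Sum>i\<in>I. x i * S i k)) + herm_form S I x"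
proof -
  let ?z = "x(k := y)"
  define c where "c = (\<Sum>i\<in>I. x i * S i k)"
  have nk: "i \<noteq> k" if "i \<in> I" for i using assms(2) that by auto
  have hk: "S i k = cnj (S k i)" if "i \<in> I" for i using herm that by blast
  have row: "(\<Sum>j\<in>I. y * S k j * cnj (x j)) = y * cnj c"
    by (simp add: c_def sum_distrib_left mult_ac hk)
  have col: "(\<Sum>i\<in>I. x i * S i k * cnj y) = c * cnj y"
    by (simp add: c_def sum_distrib_right)
  have skk: "Im (S k k) = 0"
    using arg_cong[OF herm[of k k], of Im] by simp
  have inner: "(\<Sum>j\<in>insert k I. u * S i j * cnj (?z j)) = u * S i k * cnj y + (\<Sum>j\<in>I. u * S i j * cnj (x j))"
    for u i using assms(1,2) nk by (simp cong: sum.cong)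
  have "(\<Sum>i\<in>insert k I. \<Sum>j\<in>insert k I. ?z i * S i j * cnj (?z j)) =
    y * S k k * cnj y + (\<Sum>j\<in>I. y * S k j * cnj (x j))
     + (\<Sum>i\<in>I. x i * S i k * cnj y) + (\<Sum>i\<in>I. \<Sum>j\<in>I. x i * S i j * cnj (x j))"
    unfolding inner using assms(1,2) nk by (simp add: sum.distrib cong: sum.cong)
  also have "\<dots> = y * S k k * cnj y + y * cnj c + c * cnj y
      + (\<Sum>i\<in>I. \<Sum>j\<in>I. x i * S i j * cnj (x j))"
    unfolding row col ..
  finally have "(\<Sum>i\<in>insert k I. \<Sum>j\<in>insert k I. ?z i * S i j * cnj (?z j)) = \<dots>" .
  moreover have "Re (y * S k k * cnj y) = Re (S k k) * (cmod y)\<^sup>2"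
    unfolding cmod_power2 using skk by (simp add: algebra_simps power2_eq_square)
  moreover have "Re (c * cnj y) = Re (y * cnj c)" by (simp add: mult_ac)
  ultimately show ?thesis
    unfolding herm_form_def c_def[symmetric] by (simp del: fun_upd_apply)
qed

text \<open>The double sum over \<open>S i k * S k j\<close> factors as a number times its
  conjugate, since \<open>S k j\<close> is the conjugate of \<open>S j k\<close>. For
  \<open>s = 1 / (S k k + 1/2)\<close>, the value used later, this is a Schur complement with the
  pivot shifted by 1/2.\<close>

lemma herm_form_schur:
  assumes "finite I" and herm: "\<And>i. i \<in> I \<Longrightarrow> S k i = cnj (S i k)"
  shows "herm_form (\<lambda>i j. S i j - of_real s * S i k * S k j) I x =
    herm_form S I x - s * (cmod (\<Sum>i\<in>I. x i * S i k))\<^sup>2"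
proof -
  let ?c = "\<Sum>i\<in>I. x i * S i k"
  have "(\<Sum>i\<in>I. \<Sum>j\<in>I. (x i * S i k) * cnj (x j * S j k)) = ?c * cnj ?c"
    by (simp add: sum_product)
  also have "\<dots> = of_real ((cmod ?c)\<^sup>2)" by (rule complex_norm_square[symmetric])
  finally have c: "of_real ((cmod ?c)\<^sup>2) = (\<Sum>i\<in>I. \<Sum>j\<in>I. x i * S i k * S k j * cnj (x j))"
    using herm by (auto simp: mult_ac intro!: sum.cong)
  have "(\<Sum>i\<in>I. \<Sum>j\<in>I. x i * (S i j - of_real s * S i k * S k j) * cnj (x j))
      = (\<Sum>i\<in>I. \<Sum>j\<in>I. x i * S i j * cnj (x j)) - of_real s * of_real ((cmod ?c)\<^sup>2)"
    unfolding c by (simp add: sum_distrib_left algebra_simps sum_subtractf)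
  then show ?thesis unfolding herm_form_def by simp
qed

text \<open>A discriminant argument: along \<open>y = - t * b\<close> with real \<open>t\<close> the
  polynomial is a real quadratic in \<open>t\<close>, and its minimum is attained at
  \<open>t = 1 / a\<close>. For \<open>a = 0\<close> it is affine in \<open>t\<close> and can stay
  nonnegative only if \<open>b = 0\<close>.\<close>

lemma psd_minor_le:
  fixes a d :: real and b :: complex
  assumes nonneg: "\<And>y. 0 \<le> a * (cmod y)\<^sup>2 + 2 * Re (y * cnj b) + d" and "0 \<le> a"
  shows "(cmod b)\<^sup>2 \<le> a * d"
proof -
  have *: "0 \<le> a * t\<^sup>2 * (cmod b)\<^sup>2 - 2 * t * (cmod b)\<^sup>2 + d" for t :: real
  proof -
    have "Re (- of_real t * b * cnj b) = - t * (cmod b)\<^sup>2"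
      unfolding cmod_power2 by (simp add: power2_eq_square algebra_simps)
    moreover have "(cmod (- of_real t * b))\<^sup>2 = t\<^sup>2 * (cmod b)\<^sup>2"
      by (simp add: norm_mult power_mult_distrib)
    ultimately show ?thesis using nonneg[of "- of_real t * b"] by simp
  qed
  show ?thesis
  proof (cases "a = 0")
    case False
    with assms(2) have "a > 0" by simp
    then show ?thesis using *[of "1 / a"] by (simp add: field_simps power2_eq_square)
  next
    case True
    have "b = 0"
    proof (rule ccontr)
      assume "b \<noteq> 0"
      \<comment> \<open>At this \<open>t\<close> the affine function takes the value
        \<open>d - (\<bar>d\<bar> + 1)\<close>, which is negative.\<close>
      then show False using *[of "(\<bar>d\<bar> + 1) / (2 * (cmod b)\<^sup>2)"] True by simp
    qed
    with True show ?thesis by simp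
  qed
qed

section \<open>Laplace transform of a positive semidefinite form\<close>

text \<open>The standard normal law on \<open>\<complex>\<close> satisfies this for \<open>\<beta> = 2\<close>. Only an upper bound is asked
  for, so the one on \<open>\<real>\<close>, embedded in \<open>\<complex>\<close>, satisfies it for \<open>\<beta> = 1\<close> even though its transform
  involves \<open>(Re c)\<^sup>2\<close> instead of \<open>\<bar>c\<bar>\<^sup>2\<close>.\<close>

definition laplace_dominated :: "real \<Rightarrow> complex measure \<Rightarrow> bool" where
  "laplace_dominated \<beta> N \<longleftrightarrow> prob_space N \<and> sets N = sets borel \<and>
     (\<forall>a c. 0 \<le> a \<longrightarrow>
       (\<integral>\<^sup>+z. ennreal (exp (- (a * (cmod z)\<^sup>2 + 2 * Re (z * cnj c)))) \<partial>N)
         \<le> ennreal ((1 + 2 * a) powr (- \<beta> / 2) * exp (2 * (cmod c)\<^sup>2 / (1 + 2 * a))))"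

lemma exp_herm_form_measurable:
  assumes "\<And>i. i \<in> I \<Longrightarrow> sets (N i) = sets (borel :: complex measure)"
  shows "(\<lambda>z. ennreal (exp (- herm_form S I z))) \<in> borel_measurable (PiM I N)"
proof -
  have [measurable]: "(\<lambda>z. z i) \<in> borel_measurable (PiM I N)" if "i \<in> I" for i
    using measurable_component_singleton[OF that, of N] assms[OF that]
    by (simp cong: measurable_cong_sets)
  have [measurable]: "Re \<in> borel_measurable borel" "cnj \<in> borel_measurable borel"
    by (auto intro!: borel_measurable_continuous_onI continuous_intros)
  show ?thesis unfolding herm_form_def by measurable
qed

text \<open>In eigenvalue terms the underlying estimate is that the product of the factors 1 + 2
  lambda is at least 1 + 2 tr S. Here the pivots \<open>1 + 2 * a\<close> met along the induction
  play the part of these factors. The form changes at each step, hence the induction over arbitrary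
  \<open>S\<close>.\<close>

lemma laplace_herm_form_le:
  fixes N :: "'i \<Rightarrow> complex measure"
  assumes "finite I" and dom: "\<And>i. laplace_dominated \<beta> (N i)" and "0 \<le> \<beta>"
    and "\<And>i j. i \<in> I \<Longrightarrow> j \<in> I \<Longrightarrow> S j i = cnj (S i j)"
    and "\<And>z. 0 \<le> herm_form S I z"
  shows "(\<integral>\<^sup>+z. ennreal (exp (- herm_form S I z)) \<partial>PiM I N)
    \<le> ennreal ((1 + 2 * (\<Sum>i\<in>I. Re (S i i))) powr (- \<beta> / 2))"
proof -
  interpret N: product_prob_space N
    using dom by (auto simp: laplace_dominated_def product_prob_space_def
        product_prob_space_axioms_def product_sigma_finite_def prob_space_imp_sigma_finite)
  have setsN: "sets (N i) = sets borel" for i using dom by (simp add: laplace_dominated_def)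
  show ?thesis
    using assms(1,4,5)
  proof (induction I arbitrary: S rule: finite_induct)
    case empty
    then show ?case by (simp add: herm_form_def PiM_empty)
  next
    case (insert k I)
    define a where "a = Re (S k k)"
    define c where "c x = (\<Sum>i\<in>I. x i * S i k)" for x
    \<comment> \<open>Integrating out coordinate \<open>k\<close> leaves a factor
      \<open>exp (s * (cmod (c x))\<^sup>2)\<close>; with this \<open>s\<close> it is absorbed by
      passing from \<open>S\<close> to \<open>S'\<close>.\<close>
    define s where "s = 2 / (1 + 2 * a)"
    define S' where "S' i j = S i j - of_real s * S i k * S k j" for i j
    define T where "T = (\<Sum>i\<in>I. Re (S i i))"
    have split: "herm_form S (insert k I) (x(k := y)) =
        a * (cmod y)\<^sup>2 + 2 * Re (y * cnj (c x)) + herm_form S I x" for x y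
      unfolding a_def c_def by (rule herm_form_insert[OF insert.hyps insert.prems(1)])
    have nonneg: "0 \<le> a * (cmod y)\<^sup>2 + 2 * Re (y * cnj (c x)) + herm_form S I x" for x y
      using insert.prems(2) split by metis
    have "0 \<le> a" using nonneg[of 1 "\<lambda>_. 0"] by (simp add: c_def herm_form_def)
    then have s: "0 < s" "a * s \<le> 1" by (auto simp: s_def field_simps)
    have S': "herm_form S' I x = herm_form S I x - s * (cmod (c x))\<^sup>2" for x
      unfolding S'_def c_def using insert.hyps(1)
      by (rule herm_form_schur) (use insert.prems(1) in blast)
    \<comment> \<open>The minimising \<open>y\<close> would be \<open>- c x / a\<close>, but
      \<open>a\<close> may vanish. The choice \<open>y = - s * c x\<close> suffices because
      \<open>a * s \<le> 1\<close>.\<close>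
    have psd': "0 \<le> herm_form S' I x" for x
    proof -
      have "Re (- of_real s * c x * cnj (c x)) = - s * (cmod (c x))\<^sup>2"
        unfolding cmod_power2 by (simp add: power2_eq_square algebra_simps)
      moreover have "(cmod (- of_real s * c x))\<^sup>2 = s\<^sup>2 * (cmod (c x))\<^sup>2"
        by (simp add: norm_mult power_mult_distrib)
      ultimately have "0 \<le> a * s\<^sup>2 * (cmod (c x))\<^sup>2 - 2 * s * (cmod (c x))\<^sup>2 + herm_form S I x"
        using nonneg[of "- of_real s * c x" x] by simp
      moreover have "a * s\<^sup>2 * (cmod (c x))\<^sup>2 \<le> s * (cmod (c x))\<^sup>2"
        using s mult_right_mono[of "a * s" 1 "s * (cmod (c x))\<^sup>2"]
        by (simp add: power2_eq_square mult_ac)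
      ultimately show ?thesis unfolding S' by linarith
    qed
    \<comment> \<open>Testing on the unit vector at \<open>i\<close> reduces the form to the 2x2
      principal block on \<open>i\<close> and \<open>k\<close>.\<close>
    have minor: "(cmod (S i k))\<^sup>2 \<le> a * Re (S i i)" and diag: "0 \<le> Re (S i i)" if "i \<in> I" for i
    proof -
      let ?e = "\<lambda>j. if j = i then 1 else 0 :: complex"
      have 1: "c ?e = S i k"
        using that insert.hyps(1) by (simp add: c_def mult_if_delta)
      have 2: "herm_form S I ?e = Re (S i i)"
        using that insert.hyps(1)
        by (simp add: herm_form_def if_distrib[where f = cnj] if_distrib[where f = "\<lambda>u. _ * u"]
            if_distrib[where f = "\<lambda>u. u * _"] mult_if_delta cong: if_cong)
      show "(cmod (S i k))\<^sup>2 \<le> a * Re (S i i)"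
        using nonneg[of _ ?e] \<open>0 \<le> a\<close> unfolding 1 2 by (rule psd_minor_le)
      show "0 \<le> Re (S i i)" using nonneg[of 0 ?e] unfolding 1 2 by simp
    qed
    have "0 \<le> T" unfolding T_def by (rule sum_nonneg) (rule diag)
    have "Re (S' i i) = Re (S i i) - s * (cmod (S i k))\<^sup>2" if "i \<in> I" for i
    proof -
      have "S k i = cnj (S i k)" using insert.prems(1) that by blast
      then show ?thesis
        unfolding S'_def cmod_power2 by (simp add: power2_eq_square algebra_simps)
    qed
    then have "(\<Sum>i\<in>I. Re (S' i i)) = T - s * (\<Sum>i\<in>I. (cmod (S i k))\<^sup>2)"
      by (simp add: T_def sum_subtractf sum_distrib_left)
    also have "\<dots> \<ge> T - s * (a * T)"
      using s minor by (auto simp: T_def sum_distrib_left intro!: mult_left_mono sum_mono)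
    \<comment> \<open>Since \<open>1 - s * a = 1 / (1 + 2 * a)\<close>, elimination shrinks the
      remaining trace by at most the factor \<open>1 + 2 * a\<close>, and multiplying by the pivot
      restores exactly that loss.\<close>
    finally have "(1 + 2 * a) * (1 + 2 * (T - s * (a * T)))
        \<le> (1 + 2 * a) * (1 + 2 * (\<Sum>i\<in>I. Re (S' i i)))"
      using \<open>0 \<le> a\<close> by (intro mult_left_mono) auto
    moreover have "(1 + 2 * a) * (1 + 2 * (T - s * (a * T))) = 1 + 2 * (a + T)"
      using \<open>0 \<le> a\<close> by (simp add: s_def field_simps)
    ultimately have trace: "1 + 2 * (a + T) \<le> (1 + 2 * a) * (1 + 2 * (\<Sum>i\<in>I. Re (S' i i)))"
      by simp
    have tr_nonneg: "0 \<le> 1 + 2 * (\<Sum>i\<in>I. Re (S' i i))"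
      using trace \<open>0 \<le> a\<close> \<open>0 \<le> T\<close> by (smt (verit) zero_less_mult_iff)
    have inner: "(\<integral>\<^sup>+y. ennreal (exp (- herm_form S (insert k I) (x(k := y)))) \<partial>N k)
        \<le> ennreal ((1 + 2 * a) powr (- \<beta> / 2)) * ennreal (exp (- herm_form S' I x))" for x
    proof -
      have [measurable]: "Re \<in> borel_measurable borel" "cnj \<in> borel_measurable borel"
        by (auto intro!: borel_measurable_continuous_onI continuous_intros)
      have [measurable]: "(\<lambda>y. ennreal (exp (- (a * (cmod y)\<^sup>2 + 2 * Re (y * cnj (c x))))))
          \<in> borel_measurable (N k)"
        unfolding measurable_cong_sets[OF setsN refl] by measurable
      have "(\<integral>\<^sup>+y. ennreal (exp (- herm_form S (insert k I) (x(k := y)))) \<partial>N k) =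
        (\<integral>\<^sup>+y. ennreal (exp (- herm_form S I x)) *
          ennreal (exp (- (a * (cmod y)\<^sup>2 + 2 * Re (y * cnj (c x))))) \<partial>N k)"
        unfolding split
        by (intro nn_integral_cong) (simp add: ennreal_mult' [symmetric] exp_add [symmetric])
      also have "\<dots> = ennreal (exp (- herm_form S I x)) *
          (\<integral>\<^sup>+y. ennreal (exp (- (a * (cmod y)\<^sup>2 + 2 * Re (y * cnj (c x))))) \<partial>N k)"
        by (rule nn_integral_cmult) measurable
      also have "\<dots> \<le> ennreal (exp (- herm_form S I x)) *
          ennreal ((1 + 2 * a) powr (- \<beta> / 2) * exp (2 * (cmod (c x))\<^sup>2 / (1 + 2 * a)))"
        using dom[of k] \<open>0 \<le> a\<close> by (intro mult_left_mono) (auto simp: laplace_dominated_def)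
      also have "\<dots> = ennreal ((1 + 2 * a) powr (- \<beta> / 2)) * ennreal (exp (- herm_form S' I x))"
        unfolding S' s_def
        by (simp add: ennreal_mult'[symmetric] exp_add[symmetric] exp_diff exp_minus field_simps)
      finally show ?thesis .
    qed
    have "(\<integral>\<^sup>+z. ennreal (exp (- herm_form S (insert k I) z)) \<partial>PiM (insert k I) N) =
      (\<integral>\<^sup>+x. (\<integral>\<^sup>+y. ennreal (exp (- herm_form S (insert k I) (x(k := y)))) \<partial>N k) \<partial>PiM I N)"
      using insert.hyps setsN
      by (intro N.product_nn_integral_insert exp_herm_form_measurable) auto
    also have "\<dots> \<le> (\<integral>\<^sup>+x. ennreal ((1 + 2 * a) powr (- \<beta> / 2)) *
        ennreal (exp (- herm_form S' I x)) \<partial>PiM I N)"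
      by (intro nn_integral_mono inner)
    also have "\<dots> = ennreal ((1 + 2 * a) powr (- \<beta> / 2)) *
        (\<integral>\<^sup>+x. ennreal (exp (- herm_form S' I x)) \<partial>PiM I N)"
      using setsN by (intro nn_integral_cmult exp_herm_form_measurable) auto
    also have "\<dots> \<le> ennreal ((1 + 2 * a) powr (- \<beta> / 2)) *
        ennreal ((1 + 2 * (\<Sum>i\<in>I. Re (S' i i))) powr (- \<beta> / 2))"
    proof (intro mult_left_mono insert.IH psd')
      show "S' j i = cnj (S' i j)" if "i \<in> I" "j \<in> I" for i j
      proof -
        have "S j i = cnj (S i j)" "S k i = cnj (S i k)" "S j k = cnj (S k j)"
          using insert.prems(1) that by blast+
        then show ?thesis by (simp add: S'_def)
      qed
    qed auto
    also have "\<dots> = ennreal (((1 + 2 * a) * (1 + 2 * (\<Sum>i\<in>I. Re (S' i i)))) powr (- \<beta> / 2))"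
      using \<open>0 \<le> a\<close> tr_nonneg by (simp add: ennreal_mult'[symmetric] powr_mult)
    \<comment> \<open>The exponent is nonpositive, so the lower bound on the product of the two
      bases becomes an upper bound on the power.\<close>
    also have "\<dots> \<le> ennreal ((1 + 2 * (a + T)) powr (- \<beta> / 2))"
      using trace \<open>0 \<le> a\<close> \<open>0 \<le> T\<close> \<open>0 \<le> \<beta>\<close> by (intro ennreal_leI powr_mono2') auto
    also have "a + T = (\<Sum>i\<in>insert k I. Re (S i i))"
      using insert.hyps by (simp add: a_def T_def)
    finally show ?case .
  qed
qed

section \<open>Laplace transforms of Gaussian entries\<close>

text \<open>Completing the square turns the integrand into a constant \<open>C\<close> times another
  normal density, whose integral is 1. Its precision is \<open>1 + 2 * a\<close>: 1 from the
  standard density and \<open>2 * a\<close> from the quadratic term.\<close>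

lemma nn_integral_std_normal_quadratic:
  fixes a p :: real
  assumes "0 \<le> a"
  shows "(\<integral>\<^sup>+x. ennreal (std_normal_density x) * ennreal (exp (- (a * x\<^sup>2 + 2 * (x * p)))) \<partial>lborel)
    = ennreal ((1 + 2 * a) powr (- 1 / 2) * exp (2 * p\<^sup>2 / (1 + 2 * a)))"
proof -
  define \<sigma> where "\<sigma> = 1 / sqrt (1 + 2 * a)"
  define \<mu> where "\<mu> = - 2 * p * \<sigma>\<^sup>2"
  define C where "C = \<sigma> * exp (2 * p\<^sup>2 / (1 + 2 * a))"
  have "0 < \<sigma>" and sq: "\<sigma>\<^sup>2 = 1 / (1 + 2 * a)"
    using assms by (auto simp: \<sigma>_def power_divide)
  have pointwise: "std_normal_density x * exp (- (a * x\<^sup>2 + 2 * (x * p))) = C * normal_density \<mu> \<sigma> x" for x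
  proof -
    have expo: "- (x - \<mu>)\<^sup>2 / (2 * \<sigma>\<^sup>2) = - x\<^sup>2 / 2 - (a * x\<^sup>2 + 2 * (x * p)) - 2 * p\<^sup>2 / (1 + 2 * a)"
    proof -
      define b where "b = 1 + 2 * a"
      have "b > 0" "a = (b - 1) / 2" using assms by (auto simp: b_def)
      then show ?thesis
        unfolding \<mu>_def sq b_def[symmetric] unfolding \<open>a = (b - 1) / 2\<close>
        by (simp add: divide_simps power2_eq_square) (simp add: algebra_simps)
    qed
    have root: "sqrt (2 * pi * \<sigma>\<^sup>2) = sqrt (2 * pi) * \<sigma>"
      using \<open>0 < \<sigma>\<close> by (simp add: real_sqrt_mult)
    have "C * normal_density \<mu> \<sigma> x = 1 / sqrt (2 * pi) * (exp (2 * p\<^sup>2 / (1 + 2 * a))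
        * exp (- x\<^sup>2 / 2 - (a * x\<^sup>2 + 2 * (x * p)) - 2 * p\<^sup>2 / (1 + 2 * a)))"
      unfolding normal_density_def C_def expo root using \<open>0 < \<sigma>\<close> by simp
    also have "exp (2 * p\<^sup>2 / (1 + 2 * a))
        * exp (- x\<^sup>2 / 2 - (a * x\<^sup>2 + 2 * (x * p)) - 2 * p\<^sup>2 / (1 + 2 * a))
      = exp (- x\<^sup>2 / 2) * exp (- (a * x\<^sup>2 + 2 * (x * p)))"
      unfolding exp_add[symmetric] by simp
    finally show ?thesis by (simp add: std_normal_density_def)
  qed
  interpret D: prob_space "density lborel (normal_density \<mu> \<sigma>)"
    by (rule prob_space_normal_density) fact
  have "(\<integral>\<^sup>+x. ennreal (normal_density \<mu> \<sigma> x) \<partial>lborel) = 1"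
    using D.emeasure_space_1 by (simp add: emeasure_density)
  moreover have "0 \<le> C" using \<open>0 < \<sigma>\<close> by (simp add: C_def)
  ultimately have "(\<integral>\<^sup>+x. ennreal (C * normal_density \<mu> \<sigma> x) \<partial>lborel) = ennreal C"
    by (simp add: ennreal_mult' nn_integral_cmult)
  then have "(\<integral>\<^sup>+x. ennreal (std_normal_density x) * ennreal (exp (- (a * x\<^sup>2 + 2 * (x * p)))) \<partial>lborel)
      = ennreal C"
    by (simp only: ennreal_mult'[symmetric] normal_density_nonneg pointwise)
  moreover have "\<sigma> = (1 + 2 * a) powr (- 1 / 2)"
    using assms by (simp add: \<sigma>_def powr_minus_divide powr_half_sqrt)
  ultimately show ?thesis unfolding C_def by (simp only:)
qed

lemma (in prob_space) nn_integral_std_normal_exp: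
  fixes a p :: real
  assumes "distributed M lborel X std_normal_density" "0 \<le> a"
  shows "(\<integral>\<^sup>+\<omega>. ennreal (exp (- (a * (X \<omega>)\<^sup>2 + 2 * (X \<omega> * p)))) \<partial>M)
    = ennreal ((1 + 2 * a) powr (- 1 / 2) * exp (2 * p\<^sup>2 / (1 + 2 * a)))"
  unfolding nn_integral_std_normal_quadratic[OF assms(2), symmetric]
  by (rule distributed_nn_integral[OF assms(1), symmetric]) measurable

lemma (in prob_space) laplace_dominated_distrI:
  assumes Z[measurable]: "Z \<in> borel_measurable M"
    and le: "\<And>a c. 0 \<le> a \<Longrightarrow>
      (\<integral>\<^sup>+\<omega>. ennreal (exp (- (a * (cmod (Z \<omega>))\<^sup>2 + 2 * Re (Z \<omega> * cnj c)))) \<partial>M)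
        \<le> ennreal ((1 + 2 * a) powr (- \<beta> / 2) * exp (2 * (cmod c)\<^sup>2 / (1 + 2 * a)))"
  shows "laplace_dominated \<beta> (distr M borel Z)"
  unfolding laplace_dominated_def
proof (intro conjI allI impI)
  have [measurable]: "Re \<in> borel_measurable borel" "cnj \<in> borel_measurable borel"
    by (auto intro!: borel_measurable_continuous_onI continuous_intros)
  show "(\<integral>\<^sup>+z. ennreal (exp (- (a * (cmod z)\<^sup>2 + 2 * Re (z * cnj c)))) \<partial>distr M borel Z)
      \<le> ennreal ((1 + 2 * a) powr (- \<beta> / 2) * exp (2 * (cmod c)\<^sup>2 / (1 + 2 * a)))"
    if "0 \<le> a" for a c
    using le[OF that, of c] by (subst nn_integral_distr) simp_all
qed (auto intro!: prob_space_distr)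

lemma (in prob_space) laplace_dominated_std_normal_real:
  assumes X: "distributed M lborel X std_normal_density"
  shows "laplace_dominated 1 (distr M borel (\<lambda>\<omega>. complex_of_real (X \<omega>)))"
proof -
  have [measurable]: "X \<in> borel_measurable M"
    using distributed_measurable[OF X] by simp
  have "(\<integral>\<^sup>+\<omega>. ennreal (exp (- (a * (cmod (of_real (X \<omega>)))\<^sup>2 + 2 * Re (of_real (X \<omega>) * cnj c)))) \<partial>M)
      \<le> ennreal ((1 + 2 * a) powr (- 1 / 2) * exp (2 * (cmod c)\<^sup>2 / (1 + 2 * a)))"
    if a: "0 \<le> a" for a c
  proof -
    have "(1 + 2 * a) powr (- 1 / 2) * exp (2 * (Re c)\<^sup>2 / (1 + 2 * a))
      \<le> (1 + 2 * a) powr (- 1 / 2) * exp (2 * (cmod c)\<^sup>2 / (1 + 2 * a))"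
      using a by (intro mult_left_mono) (auto simp: cmod_power2 intro!: divide_right_mono)
    then show ?thesis
      using nn_integral_std_normal_exp[OF X a, of "Re c"] by (simp add: ennreal_leI)
  qed
  then show ?thesis by (intro laplace_dominated_distrI) auto
qed

text \<open>The exponent is a sum of a term in the real part and a term in the imaginary part, so
  independence factors the expectation. The two powers -1/2 combine to -1, and
  \<open>(Re c)\<^sup>2\<close> and \<open>(Im c)\<^sup>2\<close> add up to
  \<open>(cmod c)\<^sup>2\<close>.\<close>

lemma (in prob_space) laplace_dominated_std_normal_complex:
  assumes ind: "indep_var borel (\<lambda>\<omega>. Re (Z \<omega>)) borel (\<lambda>\<omega>. Im (Z \<omega>))"
    and Re: "distributed M lborel (\<lambda>\<omega>. Re (Z \<omega>)) std_normal_density"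
    and Im: "distributed M lborel (\<lambda>\<omega>. Im (Z \<omega>)) std_normal_density"
    and Z[measurable]: "Z \<in> borel_measurable M"
  shows "laplace_dominated 2 (distr M borel Z)"
proof -
  have two: "(\<Prod>b\<in>UNIV. f b) = f True * f False" for f :: "bool \<Rightarrow> ennreal"
    by (simp add: UNIV_bool mult.commute)
  have "(\<integral>\<^sup>+\<omega>. ennreal (exp (- (a * (cmod (Z \<omega>))\<^sup>2 + 2 * Re (Z \<omega> * cnj c)))) \<partial>M)
      = ennreal ((1 + 2 * a) powr (- 2 / 2) * exp (2 * (cmod c)\<^sup>2 / (1 + 2 * a)))"
    if a: "0 \<le> a" for a c
  proof -
    let ?e = "\<lambda>p x. ennreal (exp (- (a * x\<^sup>2 + 2 * (x * p))))"
    have "indep_var borel (?e (Re c) \<circ> (\<lambda>\<omega>. Re (Z \<omega>))) borel (?e (Im c) \<circ> (\<lambda>\<omega>. Im (Z \<omega>)))"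
      by (rule indep_var_compose[OF ind]) measurable
    \<comment> \<open>\<open>indep_var\<close> is independence of a family indexed by
      \<open>bool\<close>; the conditional form makes the product rule for \<open>indep_vars\<close>
      applicable.\<close>
    then have ind': "indep_vars (\<lambda>_. borel)
        (\<lambda>b \<omega>. if b then ?e (Re c) (Re (Z \<omega>)) else ?e (Im c) (Im (Z \<omega>))) UNIV"
      unfolding indep_var_def
      by (rule indep_vars_cong[THEN iffD1, rotated -1]) (auto split: bool.splits)
    have "(\<integral>\<^sup>+\<omega>. ennreal (exp (- (a * (cmod (Z \<omega>))\<^sup>2 + 2 * Re (Z \<omega> * cnj c)))) \<partial>M)
      = (\<integral>\<^sup>+\<omega>. (\<Prod>b\<in>UNIV. if b then ?e (Re c) (Re (Z \<omega>)) else ?e (Im c) (Im (Z \<omega>))) \<partial>M)"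
      by (intro nn_integral_cong)
        (simp add: UNIV_bool ennreal_mult'[symmetric] exp_add[symmetric] cmod_power2 algebra_simps)
    also have "\<dots> = (\<Prod>b\<in>UNIV. \<integral>\<^sup>+\<omega>. (if b then ?e (Re c) (Re (Z \<omega>)) else ?e (Im c) (Im (Z \<omega>))) \<partial>M)"
      using ind' by (intro indep_vars_nn_integral) auto
    also have "\<dots> = ennreal (((1 + 2 * a) powr (- 1 / 2) * exp (2 * (Re c)\<^sup>2 / (1 + 2 * a)))
        * ((1 + 2 * a) powr (- 1 / 2) * exp (2 * (Im c)\<^sup>2 / (1 + 2 * a))))"
      by (simp only: two if_True if_False nn_integral_std_normal_exp[OF Re a]
          nn_integral_std_normal_exp[OF Im a]) (simp add: ennreal_mult' mult_ac)
    also have "((1 + 2 * a) powr (- 1 / 2) * exp (2 * (Re c)\<^sup>2 / (1 + 2 * a)))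
        * ((1 + 2 * a) powr (- 1 / 2) * exp (2 * (Im c)\<^sup>2 / (1 + 2 * a)))
      = ((1 + 2 * a) powr (- 1 / 2) * (1 + 2 * a) powr (- 1 / 2))
        * (exp (2 * (Re c)\<^sup>2 / (1 + 2 * a)) * exp (2 * (Im c)\<^sup>2 / (1 + 2 * a)))"
      by (simp only: mult_ac)
    also have "\<dots> = (1 + 2 * a) powr (- 2 / 2) * exp (2 * (cmod c)\<^sup>2 / (1 + 2 * a))"
      unfolding powr_add[symmetric] exp_add[symmetric]
      by (simp add: cmod_power2 add_divide_distrib distrib_left)
    finally show ?thesis .
  qed
  then show ?thesis by (intro laplace_dominated_distrI) auto
qed

section \<open>Laplace transform and lower tail of the sketched norm\<close>

text \<open>Each row \<open>z\<close> of \<open>Z\<close> contributes \<open>z S z^*\<close> with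
  \<open>S = t D D^*\<close>, whose trace is \<open>t * (frob_norm D)\<^sup>2\<close>. Independence
  of the rows turns the expectation into a product of \<open>CARD('q)\<close> such factors.\<close>

lemma (in prob_space) sketch_laplace_le:
  fixes Z :: "'a \<Rightarrow> complex ^ 'm ^ 'q" and D :: "complex ^ 'n ^ 'm"
  assumes ind: "indep_vars (\<lambda>_. borel) (\<lambda>(i, j) \<omega>. Z \<omega> $ i $ j) UNIV"
    and dom: "\<And>i j. laplace_dominated \<beta> (distr M borel (\<lambda>\<omega>. Z \<omega> $ i $ j))"
    and "0 \<le> \<beta>" "0 \<le> t"
  shows "(\<integral>\<^sup>+\<omega>. ennreal (exp (- t * (frob_norm (Z \<omega> ** D))\<^sup>2)) \<partial>M)
    \<le> ennreal ((1 + 2 * t * (frob_norm D)\<^sup>2) powr (- \<beta> / 2)) ^ CARD('q)"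
proof -
  define X where "X = (\<lambda>(i, j) \<omega>. Z \<omega> $ i $ j)"
  define K :: "'q \<Rightarrow> ('q \<times> 'm) set" where "K i = {i} \<times> UNIV" for i
  \<comment> \<open>Indices are matrix positions, but only the column components enter, so one
    \<open>S\<close> restricts to \<open>t D D^*\<close> on every row block
    \<open>K i\<close>.\<close>
  define S :: "'q \<times> 'm \<Rightarrow> 'q \<times> 'm \<Rightarrow> complex" where
    "S p p' = of_real t * (\<Sum>l\<in>UNIV. D $ snd p $ l * cnj (D $ snd p' $ l))" for p p'
  let ?F = "\<lambda>i z. ennreal (exp (- herm_form S (K i) z))"
  let ?B = "ennreal ((1 + 2 * t * (frob_norm D)\<^sup>2) powr (- \<beta> / 2))"
  have indX: "indep_vars (\<lambda>_. borel) X UNIV" using ind unfolding X_def .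
  then have rvX: "random_variable borel (X p)" for p unfolding indep_vars_def2 by blast
  have sumK: "(\<Sum>p\<in>K i. f p) = (\<Sum>j\<in>UNIV. f (i, j))" for f :: "_ \<Rightarrow> 'x::comm_monoid_add" and i
  proof -
    have "K i = Pair i ` UNIV" by (auto simp: K_def)
    then show ?thesis by (simp add: sum.reindex inj_on_def)
  qed
  have frob_sq: "(frob_norm A)\<^sup>2 = (\<Sum>i\<in>UNIV. \<Sum>j\<in>UNIV. (cmod (A $ i $ j))\<^sup>2)"
    for A :: "complex ^ 'b ^ 'c"
    unfolding frob_norm_def by (intro real_sqrt_pow2 sum_nonneg) auto
  have form: "herm_form S (K i) z = t * (\<Sum>l\<in>UNIV. (cmod (\<Sum>j\<in>UNIV. z (i, j) * D $ j $ l))\<^sup>2)" for i z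
  proof -
    have "(\<Sum>p\<in>K i. \<Sum>p'\<in>K i. z p * S p p' * cnj (z p')) =
      (\<Sum>j\<in>UNIV. \<Sum>j'\<in>UNIV. \<Sum>l\<in>UNIV. of_real t * ((z (i, j) * D $ j $ l) * cnj (z (i, j') * D $ j' $ l)))"
      by (simp add: sumK S_def sum_distrib_left sum_distrib_right mult_ac)
    also have "\<dots> = (\<Sum>l\<in>UNIV. \<Sum>j\<in>UNIV. \<Sum>j'\<in>UNIV. of_real t * ((z (i, j) * D $ j $ l) * cnj (z (i, j') * D $ j' $ l)))"
      by (subst sum.swap, subst (2) sum.swap) (rule refl)
    also have "\<dots> = (\<Sum>l\<in>UNIV. of_real t * ((\<Sum>j\<in>UNIV. z (i, j) * D $ j $ l) * cnj (\<Sum>j\<in>UNIV. z (i, j) * D $ j $ l)))"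
      unfolding cnj_sum unfolding sum_product unfolding sum_distrib_left ..
    also have "\<dots> = of_real (t * (\<Sum>l\<in>UNIV. (cmod (\<Sum>j\<in>UNIV. z (i, j) * D $ j $ l))\<^sup>2))"
      by (simp only: complex_norm_square[symmetric] of_real_mult of_real_sum sum_distrib_left)
    finally show ?thesis unfolding herm_form_def by simp
  qed
  have prod: "ennreal (exp (- t * (frob_norm (Z \<omega> ** D))\<^sup>2)) =
      (\<Prod>i\<in>UNIV. ?F i (restrict (\<lambda>p. X p \<omega>) (K i)))" for \<omega>
  proof -
    have "t * (frob_norm (Z \<omega> ** D))\<^sup>2 = (\<Sum>i\<in>UNIV. herm_form S (K i) (restrict (\<lambda>p. X p \<omega>) (K i)))"
      unfolding form frob_sq by (simp add: sum_distrib_left matrix_matrix_mult_def X_def K_def)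
    then show ?thesis
      by (simp add: prod_ennreal exp_sum[symmetric] sum_negf)
  qed
  have row: "(\<integral>\<^sup>+\<omega>. ?F i (restrict (\<lambda>p. X p \<omega>) (K i)) \<partial>M) \<le> ?B" for i
  proof -
    have "K i \<noteq> {}" by (simp add: K_def)
    moreover have "indep_vars (\<lambda>_. borel) X (K i)" by (rule indep_vars_subset[OF indX]) simp
    \<comment> \<open>Independence within a row makes its joint law a product measure, the setting
      of \<open>laplace_herm_form_le\<close>.\<close>
    ultimately have eq: "distr M (PiM (K i) (\<lambda>_. borel)) (\<lambda>\<omega>. restrict (\<lambda>p. X p \<omega>) (K i))
        = PiM (K i) (\<lambda>p. distr M borel (X p))"
      using rvX by (subst (asm) indep_vars_iff_distr_eq_PiM) auto
    have "(\<integral>\<^sup>+\<omega>. ?F i (restrict (\<lambda>p. X p \<omega>) (K i)) \<partial>M)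
        = (\<integral>\<^sup>+z. ?F i z \<partial>PiM (K i) (\<lambda>p. distr M borel (X p)))"
      unfolding eq[symmetric]
      using nn_integral_distr[OF measurable_restrict[OF rvX], of "?F i" "K i" "\<lambda>p. p"]
        exp_herm_form_measurable[of "K i" "\<lambda>_. borel" S]
      by simp
    also have "\<dots> \<le> ennreal ((1 + 2 * (\<Sum>p\<in>K i. Re (S p p))) powr (- \<beta> / 2))"
    proof (rule laplace_herm_form_le)
      show "laplace_dominated \<beta> (distr M borel (X p))" for p
        using dom by (cases p) (simp add: X_def)
      show "S p' p = cnj (S p p')" for p p' by (simp add: S_def mult_ac)
      show "0 \<le> herm_form S (K i) z" for z
        unfolding form using \<open>0 \<le> t\<close> by (simp add: sum_nonneg)
    qed (simp_all add: K_def \<open>0 \<le> \<beta>\<close>)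
    also have "(\<Sum>p\<in>K i. Re (S p p)) = t * (frob_norm D)\<^sup>2"
      unfolding frob_sq sumK
      by (simp add: S_def sum_distrib_left complex_norm_square[symmetric] del: of_real_power)
    finally show ?thesis by (simp only: mult.assoc)
  qed
  \<comment> \<open>Restrictions of an independent family to disjoint index blocks are
    independent.\<close>
  have "indep_vars (\<lambda>i. PiM (K i) (\<lambda>_. borel)) (\<lambda>i \<omega>. restrict (\<lambda>p. X p \<omega>) (K i)) UNIV"
    by (rule indep_vars_restrict[OF indX]) (auto simp: K_def disjoint_family_on_def)
  then have "indep_vars (\<lambda>_. borel) (\<lambda>i \<omega>. ?F i (restrict (\<lambda>p. X p \<omega>) (K i))) UNIV"
    by (rule indep_vars_compose2) (rule exp_herm_form_measurable, simp)
  then have "(\<integral>\<^sup>+\<omega>. ennreal (exp (- t * (frob_norm (Z \<omega> ** D))\<^sup>2)) \<partial>M)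
      = (\<Prod>i\<in>UNIV. \<integral>\<^sup>+\<omega>. ?F i (restrict (\<lambda>p. X p \<omega>) (K i)) \<partial>M)"
    unfolding prod by (intro indep_vars_nn_integral) auto
  also have "\<dots> \<le> (\<Prod>i\<in>(UNIV :: 'q set). ?B)"
    by (intro prod_mono_ennreal row)
  finally show ?thesis by simp
qed

text \<open>Markov's inequality is applied to \<open>exp (- t * Y)\<close>, with \<open>Y\<close>
  the squared norm of the sketch. The case \<open>D = 0\<close> has to be excluded: there the event
  is certain, while the bound is below 1 because
  \<open>1 - \<epsilon> < exp (- \<epsilon>)\<close>.\<close>

lemma (in prob_space) sketch_lower_tail:
  fixes Z :: "'a \<Rightarrow> complex ^ 'm ^ 'q" and D :: "complex ^ 'n ^ 'm"
  assumes ind: "indep_vars (\<lambda>_. borel) (\<lambda>(i, j) \<omega>. Z \<omega> $ i $ j) UNIV"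
    and dom: "\<And>i j. laplace_dominated \<beta> (distr M borel (\<lambda>\<omega>. Z \<omega> $ i $ j))"
    and "0 < \<beta>" "0 < \<epsilon>" "\<epsilon> < 1" "D \<noteq> 0"
  shows "\<P>(\<omega> in M. 1 / (\<beta> * real CARD('q)) * (frob_norm (Z \<omega> ** D))\<^sup>2 \<le> (1 - \<epsilon>) * (frob_norm D)\<^sup>2)
    \<le> (exp \<epsilon> * (1 - \<epsilon>)) powr (\<beta> * real CARD('q) / 2)"
proof -
  define F where "F = (frob_norm D)\<^sup>2"
  \<comment> \<open>This \<open>t\<close> minimises the Chernoff bound \<open>exp (2 * e * t * (1 -
    \<epsilon>) * F) * (1 + 2 * t * F) powr (- e)\<close>; the stationarity condition is
    \<open>1 + 2 * t * F = 1 / (1 - \<epsilon>)\<close>.\<close>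
  define t where "t = \<epsilon> / (2 * (1 - \<epsilon>) * F)"
  define e where "e = \<beta> * real CARD('q) / 2"
  let ?Y = "\<lambda>\<omega>. (frob_norm (Z \<omega> ** D))\<^sup>2"
  have "0 < F" using \<open>D \<noteq> 0\<close> by (simp add: F_def frob_norm_eq_norm)
  have "0 < t" using assms \<open>0 < F\<close> by (simp add: t_def)
  have "0 < e" using assms by (simp add: e_def)
  have tF: "t * ((1 - \<epsilon>) * F) = \<epsilon> / 2" "1 + 2 * t * F = 1 / (1 - \<epsilon>)"
    using assms \<open>0 < F\<close> by (simp_all add: t_def field_simps)
  \<comment> \<open>The threshold for \<open>y\<close> is
    \<open>2 * e * (1 - \<epsilon>) * F\<close>, where \<open>t * y\<close> equals
    \<open>e * \<epsilon>\<close>. The right-hand side has the shape that Markov's inequality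
    expects.\<close>
  have event: "1 / (\<beta> * real CARD('q)) * y \<le> (1 - \<epsilon>) * F \<longleftrightarrow> 1 \<le> ennreal (exp (e * \<epsilon>)) * ennreal (exp (- t * y))" for y
  proof -
    have "1 / (\<beta> * real CARD('q)) * y \<le> (1 - \<epsilon>) * F \<longleftrightarrow> y \<le> 2 * e * ((1 - \<epsilon>) * F)"
      using \<open>0 < \<beta>\<close> by (simp add: e_def field_simps)
    also have "\<dots> \<longleftrightarrow> t * y \<le> 2 * e * (t * ((1 - \<epsilon>) * F))"
      using \<open>0 < t\<close> mult_le_cancel_left_pos[of t y "2 * e * ((1 - \<epsilon>) * F)"] by (simp add: mult_ac)
    also have "\<dots> \<longleftrightarrow> 1 \<le> exp (e * \<epsilon> + - t * y)"
      unfolding tF(1) by (simp add: mult_ac)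
    also have "\<dots> \<longleftrightarrow> 1 \<le> ennreal (exp (e * \<epsilon>)) * ennreal (exp (- t * y))"
      unfolding exp_add by (simp add: ennreal_mult'[symmetric] ennreal_1[symmetric] del: ennreal_1)
    finally show ?thesis .
  qed
  have "random_variable borel ((\<lambda>(i, j) \<omega>. Z \<omega> $ i $ j) (i, j))" for i j
    using ind unfolding indep_vars_def2 by blast
  then have [measurable]: "(\<lambda>\<omega>. Z \<omega> $ i $ j) \<in> borel_measurable M" for i j by simp
  have [measurable]: "(\<lambda>\<omega>. ennreal (exp (- t * ?Y \<omega>))) \<in> borel_measurable M"
    unfolding frob_norm_def matrix_matrix_mult_def by simp
  have "emeasure M {\<omega> \<in> space M. 1 / (\<beta> * real CARD('q)) * ?Y \<omega> \<le> (1 - \<epsilon>) * F}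
      \<le> ennreal (exp (e * \<epsilon>)) * (\<integral>\<^sup>+\<omega>. ennreal (exp (- t * ?Y \<omega>)) * indicator (space M) \<omega> \<partial>M)"
    unfolding event by (rule nn_integral_Markov_inequality) measurable
  also have "(\<integral>\<^sup>+\<omega>. ennreal (exp (- t * ?Y \<omega>)) * indicator (space M) \<omega> \<partial>M)
      = (\<integral>\<^sup>+\<omega>. ennreal (exp (- t * ?Y \<omega>)) \<partial>M)"
    by (intro nn_integral_cong) simp
  also have "ennreal (exp (e * \<epsilon>)) * \<dots>
      \<le> ennreal (exp (e * \<epsilon>)) * ennreal ((1 + 2 * t * F) powr (- \<beta> / 2)) ^ CARD('q)"
    unfolding F_def using \<open>0 < \<beta>\<close> \<open>0 < t\<close>
    by (intro mult_left_mono sketch_laplace_le ind dom) auto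
  also have "\<dots> = ennreal (exp (e * \<epsilon>) * (1 / (1 - \<epsilon>)) powr (- e))"
    unfolding tF(2) using assms(5)
    by (simp add: ennreal_power ennreal_mult'[symmetric] powr_power e_def mult.commute[of \<beta>])
  also have "exp (e * \<epsilon>) * (1 / (1 - \<epsilon>)) powr (- e) = (exp \<epsilon> * (1 - \<epsilon>)) powr e"
    using assms(5) by (simp add: powr_mult exp_powr_real powr_minus powr_divide mult_ac)
  finally show ?thesis
    unfolding F_def e_def by (simp add: emeasure_eq_measure)
qed

theorem mainTheorem4:
  fixes M :: "'w measure" and \<epsilon> :: real
    and A\<^sub>R B\<^sub>R :: "real ^ 'n ^ 'm" and \<Theta>\<^sub>R :: "'w \<Rightarrow> real ^ 'm ^ 'q" and W\<^sub>R :: "'w \<Rightarrow> real ^ 'n ^ 'q"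
    and A\<^sub>C B\<^sub>C :: "complex ^ 'n ^ 'm" and \<Theta>\<^sub>C :: "'w \<Rightarrow> complex ^ 'm ^ 'q" and W\<^sub>C :: "'w \<Rightarrow> complex ^ 'n ^ 'q"
  assumes "prob_space M" and "0 < \<epsilon>" and "\<epsilon> < 1"
  shows
    "(std_normal_real_matrix M \<Theta>\<^sub>R \<and> (\<forall>\<omega>. W\<^sub>R \<omega> = \<Theta>\<^sub>R \<omega> ** A\<^sub>R) \<and> A\<^sub>R \<noteq> B\<^sub>R \<longrightarrow>
       \<P>(\<omega> in M. err_sq 1 (\<Theta>\<^sub>R \<omega>) (W\<^sub>R \<omega>) B\<^sub>R \<le> (1 - \<epsilon>) * (frob_norm (A\<^sub>R - B\<^sub>R))\<^sup>2)
         \<le> (exp \<epsilon> * (1 - \<epsilon>)) powr (1 * real CARD('q) / 2)) \<and>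
     (std_normal_complex_matrix M \<Theta>\<^sub>C \<and> (\<forall>\<omega>. W\<^sub>C \<omega> = \<Theta>\<^sub>C \<omega> ** A\<^sub>C) \<and> A\<^sub>C \<noteq> B\<^sub>C \<longrightarrow>
       \<P>(\<omega> in M. err_sq 2 (\<Theta>\<^sub>C \<omega>) (W\<^sub>C \<omega>) B\<^sub>C \<le> (1 - \<epsilon>) * (frob_norm (A\<^sub>C - B\<^sub>C))\<^sup>2)
         \<le> (exp \<epsilon> * (1 - \<epsilon>)) powr (2 * real CARD('q) / 2))"
proof -
  interpret prob_space M by fact
  show ?thesis
  proof (intro conjI impI; elim conjE)
    assume \<Theta>: "std_normal_real_matrix M \<Theta>\<^sub>R" and W: "\<forall>\<omega>. W\<^sub>R \<omega> = \<Theta>\<^sub>R \<omega> ** A\<^sub>R" and "A\<^sub>R \<noteq> B\<^sub>R"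
    \<comment> \<open>The real case is transferred to complex matrices by the entrywise embedding,
      which preserves products, Frobenius norms and independence of the entries; the value 1 of
      \<beta> survives because \<open>laplace_dominated\<close> only asks for an upper
      bound.\<close>
    let ?C = "\<lambda>A. \<chi> i j. complex_of_real (A $ i $ j)"
    have frob: "frob_norm (?C A) = frob_norm A" for A :: "real ^ 'b ^ 'c"
      by (simp add: frob_norm_def)
    have mult: "?C (T ** A) = ?C T ** ?C A" for T :: "real ^ 'm ^ 'q" and A :: "real ^ 'n ^ 'm"
      by (simp add: vec_eq_iff matrix_matrix_mult_def)
    have ind: "indep_vars (\<lambda>_. borel) (\<lambda>(i, j) \<omega>. \<Theta>\<^sub>R \<omega> $ i $ j) UNIV"
      and dist: "distributed M lborel (\<lambda>\<omega>. \<Theta>\<^sub>R \<omega> $ i $ j) std_normal_density" for i j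
      using \<Theta> by (auto simp: std_normal_real_matrix_def)
    have "indep_vars (\<lambda>_. borel) (\<lambda>p \<omega>. complex_of_real ((\<lambda>(i, j) \<omega>. \<Theta>\<^sub>R \<omega> $ i $ j) p \<omega>)) UNIV"
      by (rule indep_vars_compose2[OF ind]) measurable
    then have "indep_vars (\<lambda>_. borel) (\<lambda>(i, j) \<omega>. ?C (\<Theta>\<^sub>R \<omega>) $ i $ j) UNIV"
      by (simp add: case_prod_beta')
    moreover have "laplace_dominated 1 (distr M borel (\<lambda>\<omega>. ?C (\<Theta>\<^sub>R \<omega>) $ i $ j))" for i j
      using laplace_dominated_std_normal_real[OF dist[of i j]] by simp
    moreover have "?C (A\<^sub>R - B\<^sub>R) \<noteq> 0"
      using \<open>A\<^sub>R \<noteq> B\<^sub>R\<close> by (simp add: vec_eq_iff)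
    ultimately have "\<P>(\<omega> in M. 1 / (1 * real CARD('q)) * (frob_norm (?C (\<Theta>\<^sub>R \<omega>) ** ?C (A\<^sub>R - B\<^sub>R)))\<^sup>2
          \<le> (1 - \<epsilon>) * (frob_norm (?C (A\<^sub>R - B\<^sub>R)))\<^sup>2)
        \<le> (exp \<epsilon> * (1 - \<epsilon>)) powr (1 * real CARD('q) / 2)"
      using assms(2,3) by (intro sketch_lower_tail) auto
    then show "\<P>(\<omega> in M. err_sq 1 (\<Theta>\<^sub>R \<omega>) (W\<^sub>R \<omega>) B\<^sub>R \<le> (1 - \<epsilon>) * (frob_norm (A\<^sub>R - B\<^sub>R))\<^sup>2)
        \<le> (exp \<epsilon> * (1 - \<epsilon>)) powr (1 * real CARD('q) / 2)"
      unfolding W[rule_format] err_sq_sketch mult[symmetric] frob .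
  next
    assume \<Theta>: "std_normal_complex_matrix M \<Theta>\<^sub>C" and W: "\<forall>\<omega>. W\<^sub>C \<omega> = \<Theta>\<^sub>C \<omega> ** A\<^sub>C" and "A\<^sub>C \<noteq> B\<^sub>C"
    have ind: "indep_vars (\<lambda>_. borel) (\<lambda>(i, j) \<omega>. \<Theta>\<^sub>C \<omega> $ i $ j) UNIV"
      using \<Theta> by (simp add: std_normal_complex_matrix_def)
    have "random_variable borel ((\<lambda>(i, j) \<omega>. \<Theta>\<^sub>C \<omega> $ i $ j) (i, j))" for i j
      using ind unfolding indep_vars_def2 by blast
    then have "laplace_dominated 2 (distr M borel (\<lambda>\<omega>. \<Theta>\<^sub>C \<omega> $ i $ j))" for i j
      using \<Theta> by (intro laplace_dominated_std_normal_complex) (auto simp: std_normal_complex_matrix_def)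
    then show "\<P>(\<omega> in M. err_sq 2 (\<Theta>\<^sub>C \<omega>) (W\<^sub>C \<omega>) B\<^sub>C \<le> (1 - \<epsilon>) * (frob_norm (A\<^sub>C - B\<^sub>C))\<^sup>2)
        \<le> (exp \<epsilon> * (1 - \<epsilon>)) powr (2 * real CARD('q) / 2)"
      unfolding W[rule_format] err_sq_sketch
      using assms(2,3) ind \<open>A\<^sub>C \<noteq> B\<^sub>C\<close> by (intro sketch_lower_tail) auto
  qed
qed

end
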